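(* Let $B$ be a finite perfect two-sided skew brace. Then: (1) $B=B^{2}\circ B^{2,\operatorname{op}}$, i.e. $B$ is the internal central product of its ideals $B^2$ and $B^{2,\operatorname{op}}$; (2) $B^2$ is almost trivial with perfect additive group; (3) $B^{2,\operatorname{op}}$ is trivial with perfect additive group.
   Context: A skew brace is a triple $(B,+,\cdot)$ such that $(B,+)$ and $(B,\cdot)$ are groups (neither assumed abelian) and $a\cdot(b+c)=a\cdot b-a+a\cdot c$ for all $a,b,c\in B$; both groups have the same identity, denoted $0$. It is two-sided if moreover $(a+b)c=ac-c+bc$ for all $a,b,c\in B$. For $b\in B$ put $\lambda_b(a)=-b+ba$. A subset $I\subseteq B$ is an ideal if $(I,+)\trianglelefteq(B,+)$, $(I,\cdot)\trianglelefteq(B,\cdot)$ and $\lambda_b(I)\subseteq I$ for all $b\in B$; ideals are themselves skew braces under the restricted operations. The center $Z(B)$ is the set of $z\in B$ that are central in both $(B,+)$ and $(B,\cdot)$ and satisfy $\lambda_z=\operatorname{id}_B$. For $a,b\in B$ let $a*b=-a+ab-b$, and for $X,Y\subseteq B$ let $X*Y$ be the additive subgroup generated by all $x*y$, $x\in X$, $y\in Y$. Put $B^2=B*B$. The opposite skew brace is $B^{\operatorname{op}}=(B,+^{\operatorname{op}},\cdot)$ with $a+^{\operatorname{op}}b=b+a$, and $B^{2,\operatorname{op}}=(B^{\operatorname{op}})^2$. Both $B^2$ and $B^{2,\operatorname{op}}$ are ideals of $B$. A skew brace $A$ is trivial if $A^2=0$ (equivalently $ab=a+b$ for all $a,b\in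 A$) and almost trivial if $A^{2,\operatorname{op}}=0$ (equivalently $ab=b+a$ for all $a,b\in A$). The commutator ideal $[B,B]^B$ is the ideal of $B$ generated by the additive commutators, the multiplicative commutators and the elements $ab-(a+b)$, $a,b\in B$. The skew brace $B$ is perfect if $B=[B,B]^B$. A group is perfect if it equals its derived subgroup. For ideals $I,J$ of $B$, $B$ is the internal central product of $I$ and $J$, written $B=I\circ J$, if $B=I+J$, $[I,J]_+=0$ (additive commutators of elements of $I$ with elements of $J$ vanish), $I*J=J*I=0$, and $I\cap J\le Z(B)$. *)

theory Defs
  imports "HOL-Algebra.AbelCoset" "HOL-Algebra.Generated_Groups"
begin

text \<open>
  A skew brace is carried by a ring record: the additive group is \<^term>\<open>add_monoid B\<close>, the
  multiplicative group is \<^term>\<open>B\<close> itself.  The sub-structure on a subset \<open>I\<close> of the carrier is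
  \<open>B\<lparr>carrier := I\<rparr>\<close>.
\<close>

locale skew_brace =
  fixes B (structure)
  assumes add_group: "group (add_monoid B)"
    and mult_group: "group B"
    and left_skew_distrib:
      "\<lbrakk>a \<in> carrier B; b \<in> carrier B; c \<in> carrier B\<rbrakk>
        \<Longrightarrow> a \<otimes> (b \<oplus> c) = a \<otimes> b \<ominus> a \<oplus> a \<otimes> c"

locale two_sided_skew_brace = skew_brace +
  assumes right_skew_distrib:
      "\<lbrakk>a \<in> carrier B; b \<in> carrier B; c \<in> carrier B\<rbrakk>
        \<Longrightarrow> (a \<oplus> b) \<otimes> c = a \<otimes> c \<ominus> c \<oplus> b \<otimes> c"

text \<open>The record has separate fields for the two identities; the axioms force them to agree.\<close>

lemma (in skew_brace) one_eq_zero: "\<one> = \<zero>"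
proof -
  interpret A: group "add_monoid B" by (rule add_group)
  interpret M: group B by (rule mult_group)
  have z: "\<zero> \<in> carrier B" using A.one_closed by simp
  have zz: "\<zero> \<oplus> \<zero> = \<zero>" using A.l_one[of "\<zero>"] z by simp
  have ni: "\<ominus> \<one> \<in> carrier B" using A.inv_closed[of "\<one>"] by (simp add: a_inv_def)
  have "\<zero> = \<zero> \<ominus> \<one> \<oplus> \<zero>"
    using left_skew_distrib[of "\<one>" "\<zero>" "\<zero>"] z zz by simp
  also have "\<dots> = \<ominus> \<one>"
    using A.l_one[of "\<ominus> \<one>"] A.r_one[of "\<ominus> \<one>"] ni by (simp add: a_minus_def)
  finally have "\<zero> = \<ominus> \<one>" .
  then show ?thesis
    using A.l_inv[of "\<one>"] A.l_one[of "\<one>"] by (simp add: a_inv_def)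
qed

definition lambda_map :: "('a, 'm) ring_scheme \<Rightarrow> 'a \<Rightarrow> 'a \<Rightarrow> 'a"
  where "lambda_map B b a = \<ominus>\<^bsub>B\<^esub> b \<oplus>\<^bsub>B\<^esub> (b \<otimes>\<^bsub>B\<^esub> a)"

definition brace_ideal :: "'a set \<Rightarrow> ('a, 'm) ring_scheme \<Rightarrow> bool"
  where "brace_ideal I B \<longleftrightarrow>
    I \<lhd> add_monoid B \<and> I \<lhd> B \<and> (\<forall>b\<in>carrier B. lambda_map B b ` I \<subseteq> I)"

definition brace_center :: "('a, 'm) ring_scheme \<Rightarrow> 'a set"
  where "brace_center B = {z \<in> carrier B.
    (\<forall>a\<in>carrier B. z \<oplus>\<^bsub>B\<^esub> a = a \<oplus>\<^bsub>B\<^esub> z) \<and>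
    (\<forall>a\<in>carrier B. z \<otimes>\<^bsub>B\<^esub> a = a \<otimes>\<^bsub>B\<^esub> z) \<and>
    (\<forall>a\<in>carrier B. lambda_map B z a = a)}"

definition star :: "('a, 'm) ring_scheme \<Rightarrow> 'a \<Rightarrow> 'a \<Rightarrow> 'a"
  where "star B a b = \<ominus>\<^bsub>B\<^esub> a \<oplus>\<^bsub>B\<^esub> (a \<otimes>\<^bsub>B\<^esub> b) \<ominus>\<^bsub>B\<^esub> b"

definition star_set :: "('a, 'm) ring_scheme \<Rightarrow> 'a set \<Rightarrow> 'a set \<Rightarrow> 'a set"
  where "star_set B S T = generate (add_monoid B) {star B x y | x y. x \<in> S \<and> y \<in> T}"

definition brace_square :: "('a, 'm) ring_scheme \<Rightarrow> 'a set"
  where "brace_square B = star_set B (carrier B) (carrier B)"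

definition opposite :: "('a, 'm) ring_scheme \<Rightarrow> ('a, 'm) ring_scheme"
  where "opposite B = B\<lparr>add := \<lambda>a b. b \<oplus>\<^bsub>B\<^esub> a\<rparr>"

definition op_square :: "('a, 'm) ring_scheme \<Rightarrow> 'a set"
  where "op_square B = brace_square (opposite B)"

definition trivial_skew_brace :: "('a, 'm) ring_scheme \<Rightarrow> bool"
  where "trivial_skew_brace A \<longleftrightarrow> skew_brace A \<and> brace_square A = {\<zero>\<^bsub>A\<^esub>}"

definition almost_trivial_skew_brace :: "('a, 'm) ring_scheme \<Rightarrow> bool"
  where "almost_trivial_skew_brace A \<longleftrightarrow> skew_brace A \<and> op_square A = {\<zero>\<^bsub>A\<^esub>}"

definition ideal_generated :: "('a, 'm) ring_scheme \<Rightarrow> 'a set \<Rightarrow> 'a set"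
  where "ideal_generated B S = \<Inter>{I. brace_ideal I B \<and> S \<subseteq> I}"

definition add_commutator :: "('a, 'm) ring_scheme \<Rightarrow> 'a \<Rightarrow> 'a \<Rightarrow> 'a"
  where "add_commutator B a b = a \<oplus>\<^bsub>B\<^esub> b \<ominus>\<^bsub>B\<^esub> a \<ominus>\<^bsub>B\<^esub> b"

definition mult_commutator :: "('a, 'm) monoid_scheme \<Rightarrow> 'a \<Rightarrow> 'a \<Rightarrow> 'a"
  where "mult_commutator B a b = a \<otimes>\<^bsub>B\<^esub> b \<otimes>\<^bsub>B\<^esub> inv\<^bsub>B\<^esub> a \<otimes>\<^bsub>B\<^esub> inv\<^bsub>B\<^esub> b"

definition commutator_ideal :: "('a, 'm) ring_scheme \<Rightarrow> 'a set"
  where "commutator_ideal B = ideal_generated B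
    ({add_commutator B a b | a b. a \<in> carrier B \<and> b \<in> carrier B} \<union>
     {mult_commutator B a b | a b. a \<in> carrier B \<and> b \<in> carrier B} \<union>
     {(a \<otimes>\<^bsub>B\<^esub> b) \<ominus>\<^bsub>B\<^esub> (a \<oplus>\<^bsub>B\<^esub> b) | a b. a \<in> carrier B \<and> b \<in> carrier B})"

definition perfect_skew_brace :: "('a, 'm) ring_scheme \<Rightarrow> bool"
  where "perfect_skew_brace B \<longleftrightarrow> skew_brace B \<and> carrier B = commutator_ideal B"

definition perfect_group :: "('a, 'm) monoid_scheme \<Rightarrow> bool"
  where "perfect_group G \<longleftrightarrow> group G \<and> carrier G = derived G (carrier G)"

definition internal_central_product ::
    "('a, 'm) ring_scheme \<Rightarrow> 'a set \<Rightarrow> 'a set \<Rightarrow> bool"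
  where "internal_central_product B I J \<longleftrightarrow>
    brace_ideal I B \<and> brace_ideal J B \<and>
    carrier B = I <+>\<^bsub>B\<^esub> J \<and>
    (\<forall>x\<in>I. \<forall>y\<in>J. add_commutator B x y = \<zero>\<^bsub>B\<^esub>) \<and>
    star_set B I J = {\<zero>\<^bsub>B\<^esub>} \<and> star_set B J I = {\<zero>\<^bsub>B\<^esub>} \<and>
    I \<inter> J \<subseteq> brace_center B"

end

theory Submission
  imports Defs
begin

text \<open>
  Expanding \<open>(a + b)(c + d)\<close> in two ways shows that \<open>I = B\<^sup>2\<close> and \<open>J = B\<^sup>2\<^sup>,\<^sup>o\<^sup>p\<close> commute additively.
  A Nakayama argument in the quotient of \<open>B\<close> by its additive derived subgroup, a finite
  perfect radical ring, shows that this quotient is zero, so \<open>(B,+)\<close> is perfect.  The additive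
  commutators lie in \<open>I + J\<close>, hence \<open>B = I + J\<close> and \<open>I \<inter> J\<close> is additively central.
  Modulo \<open>[I,I]\<^sub>+\<close> the map \<open>b \<mapsto> a * b\<close> is additive from the perfect group \<open>B\<close> to an
  abelian group, so it vanishes and \<open>I = [I,I]\<^sub>+\<close>; dually for \<open>J\<close>.  Likewise \<open>*\<close> is additive in an
  argument as soon as its values lie in \<open>I \<inter> J\<close>, so it vanishes when that argument runs through
  one of the perfect groups \<open>B\<close>, \<open>I\<close>, \<open>J\<close>; this gives every remaining claim.
\<close>

section \<open>Perfect groups and homomorphisms into abelian sections\<close>

lemma (in group) inv_mult_cancel_left:
  "\<lbrakk>x \<in> carrier G; y \<in> carrier G\<rbrakk> \<Longrightarrow> inv x \<otimes> (x \<otimes> y) = y"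
  by (simp flip: m_assoc)

lemma (in group) mult_inv_cancel_left:
  "\<lbrakk>x \<in> carrier G; y \<in> carrier G\<rbrakk> \<Longrightarrow> x \<otimes> (inv x \<otimes> y) = y"
  by (simp flip: m_assoc)

lemma (in group) commutatorI_derived:
  "\<lbrakk>x \<in> H; y \<in> H\<rbrakk> \<Longrightarrow> x \<otimes> y \<otimes> inv x \<otimes> inv y \<in> derived G H"
  unfolding derived_def by (rule generate.incl) blast

text \<open>A homomorphism from a perfect group to an abelian group is trivial. The target here is
  the section \<open>C\<close> modulo \<open>K\<close>; since \<open>f\<close> takes values in
  \<open>C\<close> and is multiplicative only up to \<open>K\<close>, applications need not mention
  cosets. Normality of \<open>K\<close> in \<open>C\<close> comes from \<open>comm\<close>.\<close>

lemma (in group) hom_modulo_in_subgroup_if_perfect: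
  assumes P: "subgroup P G" "derived G P = P"
    and C: "subgroup C G" and K: "subgroup K G" "K \<subseteq> C"
    and comm: "\<And>c d. \<lbrakk>c \<in> C; d \<in> C\<rbrakk> \<Longrightarrow> c \<otimes> d \<otimes> inv c \<otimes> inv d \<in> K"
    and f: "\<And>x. x \<in> P \<Longrightarrow> f x \<in> C"
    and f_mult: "\<And>x y. \<lbrakk>x \<in> P; y \<in> P\<rbrakk> \<Longrightarrow> f (x \<otimes> y) \<otimes> inv (f x \<otimes> f y) \<in> K"
    and x: "x \<in> P"
  shows "f x \<in> K"
proof -
  let ?P = "G\<lparr>carrier := P\<rparr>" and ?C = "G\<lparr>carrier := C\<rparr>"
  let ?Q = "?C Mod K"
  let ?h = "\<lambda>x. K #> f x"
  interpret P: group ?P by (rule subgroup_imp_group[OF P(1)])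
  interpret C: group ?C by (rule subgroup_imp_group[OF C])
  have Cc: "C \<subseteq> carrier G" and Kc: "K \<subseteq> carrier G"
    using subgroup.subset[OF C] subgroup.subset[OF K(1)] .
  have coset_eq: "K #> c = K #> d" if "c \<in> C" "d \<in> C" "c \<otimes> inv d \<in> K" for c d
  proof -
    have "c = (c \<otimes> inv d) \<otimes> d" using that Cc by (simp add: m_assoc subset_iff)
    then have "c \<in> K #> d" using that(3) unfolding r_coset_def by blast
    then show ?thesis using repr_independence[OF _ _ K(1)] that Cc by blast
  qed
  have "K \<lhd> ?C"
    unfolding C.normal_inv_iff
  proof (intro conjI ballI)
    show "subgroup K ?C" by (rule subgroup_incl[OF K(1) C K(2)])
    fix c k assume "c \<in> carrier ?C" "k \<in> K"
    then have c: "c \<in> C" "c \<in> carrier G" and k: "k \<in> K" "k \<in> C" "k \<in> carrier G"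
      using K(2) Cc by auto
    \<comment> \<open>The conjugate of \<open>k\<close> by \<open>c\<close> is their commutator
      times \<open>k\<close>.\<close>
    have "(c \<otimes> k \<otimes> inv c \<otimes> inv k) \<otimes> k \<in> K"
      using subgroup.m_closed[OF K(1) comm[OF c(1) k(2)] k(1)] .
    then show "c \<otimes>\<^bsub>?C\<^esub> k \<otimes>\<^bsub>?C\<^esub> inv\<^bsub>?C\<^esub> c \<in> K"
      using c k C by (simp add: m_assoc)
  qed
  then interpret K: normal K ?C .
  have mod_mult: "(K #> c) <#> (K #> d) = K #> (c \<otimes> d)" if "c \<in> C" "d \<in> C" for c d
    using K.rcos_sum[of c d] that by simp
  have "group ?Q" by (rule K.factorgroup_is_group)
  moreover have "M \<otimes>\<^bsub>?Q\<^esub> N = N \<otimes>\<^bsub>?Q\<^esub> M" if MN: "M \<in> carrier ?Q" "N \<in> carrier ?Q" for M N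
  proof -
    obtain c d where cd: "c \<in> C" "d \<in> C" "M = K #> c" "N = K #> d"
      using MN by (auto simp: carrier_FactGroup)
    have "c \<otimes> d \<otimes> inv (d \<otimes> c) \<in> K"
      using comm[OF cd(1,2)] cd(1,2) Cc by (simp add: m_assoc inv_mult_group subset_iff)
    then have "K #> (c \<otimes> d) = K #> (d \<otimes> c)"
      using coset_eq subgroup.m_closed[OF C] cd(1,2) by blast
    then show ?thesis using cd by (simp add: mod_mult)
  qed
  ultimately have "comm_group ?Q" by (metis group.group_comm_groupI)
  then interpret Q: comm_group ?Q .
  have "?h \<in> hom ?P ?Q"
  proof (rule homI)
    fix x assume "x \<in> carrier ?P"
    then show "?h x \<in> carrier ?Q" using f by (auto simp: carrier_FactGroup)
  next
    fix x y assume "x \<in> carrier ?P" "y \<in> carrier ?P"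
    then have "x \<in> P" "y \<in> P" by auto
    then show "?h (x \<otimes>\<^bsub>?P\<^esub> y) = ?h x \<otimes>\<^bsub>?Q\<^esub> ?h y"
      using coset_eq[OF _ _ f_mult] f subgroup.m_closed[OF C] subgroup.m_closed[OF P(1)]
      by (simp add: mod_mult)
  qed
  then interpret h: group_hom ?P ?Q ?h by unfold_locales
  \<comment> \<open>Perfectness of \<open>P\<close> makes its image equal to the derived subgroup of
    that image, which is trivial in an abelian group.\<close>
  have "?h ` P = ?h ` derived ?P P"
    using derived_consistent[OF _ P(1), of P] P(2) by simp
  also have "\<dots> = derived ?Q (?h ` P)"
    using h.derived_img[of P] by simp
  also have "\<dots> = {\<one>\<^bsub>?Q\<^esub>}"
    using h.hom_closed by (intro Q.derived_eq_singleton) auto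
  finally have "K #> f x = K" using x by auto
  then show ?thesis using coset_join1[OF _ _ K(1)] Cc Kc f[OF x] by auto
qed

section \<open>Additive calculus of the lambda maps and of \<open>star\<close>\<close>

sublocale skew_brace \<subseteq> add: group "add_monoid B"
  rewrites "carrier (add_monoid B) = carrier B"
    and "mult (add_monoid B) = add B"
    and "one (add_monoid B) = zero B"
    and "m_inv (add_monoid B) = a_inv B"
  by (rule add_group) (simp_all add: a_inv_def)

sublocale skew_brace \<subseteq> group B
  by (rule mult_group)

context skew_brace
begin

abbreviation lam ("\<Lambda>")
  where "\<Lambda> \<equiv> lambda_map B"

text \<open>Rewriting with these brings noncommutative additive words to right-nested form with
  adjacent inverse pairs cancelled.\<close>

lemmas add_simps = a_minus_def add.m_assoc add.inv_mult_group
  add.inv_mult_cancel_left add.mult_inv_cancel_left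

lemma lambda_closed [simp]: "\<lbrakk>a \<in> carrier B; b \<in> carrier B\<rbrakk> \<Longrightarrow> \<Lambda> a b \<in> carrier B"
  by (simp add: lambda_map_def)

lemma star_closed [simp]: "\<lbrakk>a \<in> carrier B; b \<in> carrier B\<rbrakk> \<Longrightarrow> star B a b \<in> carrier B"
  by (simp add: star_def a_minus_def)

lemma mult_eq_lambda: "\<lbrakk>a \<in> carrier B; b \<in> carrier B\<rbrakk> \<Longrightarrow> a \<otimes> b = a \<oplus> \<Lambda> a b"
  by (simp add: lambda_map_def add_simps)

lemma star_eq_lambda: "\<lbrakk>a \<in> carrier B; b \<in> carrier B\<rbrakk> \<Longrightarrow> star B a b = \<Lambda> a b \<ominus> b"
  by (simp add: lambda_map_def star_def)

lemma mult_eq_star: "\<lbrakk>a \<in> carrier B; b \<in> carrier B\<rbrakk> \<Longrightarrow> a \<otimes> b = a \<oplus> star B a b \<oplus> b"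
  by (simp add: star_def add_simps)

text \<open>Left skew distributivity with \<open>\<ominus> a\<close> added on the left.\<close>

lemma lambda_add:
  assumes "a \<in> carrier B" "b \<in> carrier B" "c \<in> carrier B"
  shows "\<Lambda> a (b \<oplus> c) = \<Lambda> a b \<oplus> \<Lambda> a c"
  using assms by (simp add: lambda_map_def left_skew_distrib add_simps)

lemma group_hom_lambda: "a \<in> carrier B \<Longrightarrow> group_hom (add_monoid B) (add_monoid B) (\<Lambda> a)"
  by (auto intro!: group_hom.intro group_hom_axioms.intro homI add_group simp: lambda_add)

lemma lambda_minus:
  "\<lbrakk>a \<in> carrier B; b \<in> carrier B\<rbrakk> \<Longrightarrow> \<Lambda> a (\<ominus> b) = \<ominus> \<Lambda> a b"
  using group_hom.hom_inv[OF group_hom_lambda] by (simp add: a_inv_def)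

text \<open>Expand \<open>\<Lambda> b c\<close> and use additivity of \<open>\<Lambda> a\<close>;
  the two copies of \<open>a\<close> cancel. With \<open>lambda_one\<close>, the multiplicative
  group acts on the additive one by automorphisms.\<close>

lemma lambda_mult:
  assumes "a \<in> carrier B" "b \<in> carrier B" "c \<in> carrier B"
  shows "\<Lambda> (a \<otimes> b) c = \<Lambda> a (\<Lambda> b c)"
proof -
  have "\<Lambda> a (\<Lambda> b c) = \<ominus> \<Lambda> a b \<oplus> \<Lambda> a (b \<otimes> c)"
    using assms by (simp add: lambda_map_def[of B b] lambda_add lambda_minus)
  also have "\<dots> = \<Lambda> (a \<otimes> b) c"
    using assms by (simp add: lambda_map_def add_simps m_assoc)
  finally show ?thesis ..
qed

lemma lambda_one: "c \<in> carrier B \<Longrightarrow> \<Lambda> \<one> c = c"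
  by (simp add: lambda_map_def) (simp add: one_eq_zero)

text \<open>\<open>star B a\<close> is a crossed homomorphism: it becomes additive wherever
  conjugation by \<open>b\<close> acts trivially on the second value.\<close>

lemma star_add_right:
  assumes "a \<in> carrier B" "b \<in> carrier B" "c \<in> carrier B"
  shows "star B a (b \<oplus> c) = star B a b \<oplus> b \<oplus> star B a c \<ominus> b"
  using assms by (simp add: star_eq_lambda lambda_add add_simps)

text \<open>Both sides equal \<open>\<Lambda> (a \<otimes> b) c \<ominus> \<Lambda> a c\<close>.
  Lambda-stability of subgroups built from stars rests on this.\<close>

lemma lambda_star:
  assumes "a \<in> carrier B" "b \<in> carrier B" "c \<in> carrier B"
  shows "\<Lambda> a (star B b c) = star B (a \<otimes> b) c \<ominus> star B a c"
  using assms by (simp add: star_eq_lambda lambda_add lambda_minus lambda_mult a_minus_def)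
    (simp add: add_simps)

lemma lambda_add_commutator:
  assumes "a \<in> carrier B" "b \<in> carrier B" "c \<in> carrier B"
  shows "\<Lambda> a (add_commutator B b c) = add_commutator B (\<Lambda> a b) (\<Lambda> a c)"
  using assms by (simp add: add_commutator_def a_minus_def lambda_add lambda_minus)

lemma image_generate_subset:
  assumes "group_hom (add_monoid B) (add_monoid B) h" "S \<subseteq> carrier B"
    and "h ` S \<subseteq> generate (add_monoid B) S"
  shows "h ` generate (add_monoid B) S \<subseteq> generate (add_monoid B) S"
  using assms group_hom.generate_img[OF assms(1), of S]
    add.generate_subgroup_incl[OF assms(3)] add.generate_is_subgroup[OF assms(2)]
  by simp

end

section \<open>Ideals, their generation, and \<open>brace_square\<close>\<close>

lemma (in skew_brace) brace_idealI:
  assumes N: "N \<lhd> add_monoid B"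
    and lam: "\<And>b x. \<lbrakk>b \<in> carrier B; x \<in> N\<rbrakk> \<Longrightarrow> \<Lambda> b x \<in> N"
    and conj: "\<And>b x. \<lbrakk>b \<in> carrier B; x \<in> N\<rbrakk> \<Longrightarrow> b \<otimes> x \<otimes> inv b \<in> N"
  shows "brace_ideal N B"
proof -
  have sub: "subgroup N (add_monoid B)" using N by (rule normal_imp_subgroup)
  have Nc: "\<And>x. x \<in> N \<Longrightarrow> x \<in> carrier B" using subgroup.subset[OF sub] by auto
  \<comment> \<open>Multiplicative closure follows from lambda-stability, because
    \<open>x \<otimes> y = x \<oplus> \<Lambda> x y\<close> and
    \<open>inv x = \<Lambda> (inv x) (\<ominus> x)\<close>.\<close>
  have "subgroup N B"
  proof (rule subgroupI)
    show "N \<subseteq> carrier B" using Nc by auto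
    show "N \<noteq> {}" using subgroup.one_closed[OF sub] by auto
  next
    fix x assume x: "x \<in> N"
    note [simp] = Nc[OF x]
    have "\<zero> = x \<oplus> \<Lambda> x (inv x)" by (simp flip: mult_eq_lambda add: one_eq_zero)
    then have "\<Lambda> x (inv x) = \<ominus> x"
      by (metis Nc add.inv_equality add.inv_inv add.inv_closed inv_closed lambda_closed x)
    then have "inv x = \<Lambda> (inv x) (\<ominus> x)"
      by (metis Nc x inv_closed l_inv lambda_mult lambda_one)
    moreover have "\<ominus> x \<in> N" using subgroup.m_inv_closed[OF sub x] by (simp add: a_inv_def)
    ultimately show "inv x \<in> N" using lam[of "inv x" "\<ominus> x"] by simp
  next
    fix x y assume "x \<in> N" "y \<in> N"
    then show "x \<otimes> y \<in> N"
      using mult_eq_lambda[of x y] subgroup.m_closed[OF sub, of x "\<Lambda> x y"] lam[of x y] Nc by simp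
  qed
  then have "N \<lhd> B" using conj by (simp add: normal_inv_iff)
  then show ?thesis using N lam by (auto simp: brace_ideal_def)
qed

context two_sided_skew_brace
begin

text \<open>Right multiplication by \<open>d\<close> is additive up to a correction by
  \<open>d\<close>; in an alternating sum of three terms the corrections cancel.\<close>

lemma minus_add_mult:
  assumes "a \<in> carrier B" "b \<in> carrier B" "c \<in> carrier B" "d \<in> carrier B"
  shows "(a \<ominus> b \<oplus> c) \<otimes> d = a \<otimes> d \<ominus> b \<otimes> d \<oplus> c \<otimes> d"
proof -
  have "a \<otimes> d = (a \<ominus> b \<oplus> b) \<otimes> d"
    using assms by (simp add: add_simps)
  also have "\<dots> = (a \<ominus> b) \<otimes> d \<ominus> d \<oplus> b \<otimes> d"
    using assms right_skew_distrib[of "a \<ominus> b" b d] by (simp add: a_minus_def)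
  finally have "(a \<ominus> b) \<otimes> d = a \<otimes> d \<ominus> b \<otimes> d \<oplus> d"
    using assms by (simp add: add_simps)
  then show ?thesis
    using assms right_skew_distrib[of "a \<ominus> b" c d] by (simp add: add_simps)
qed

text \<open>Combining both distributive laws leaves the single correction
  \<open>c \<otimes> inv c\<close>, which is zero. Multiplicative conjugation is thus additive,
  which is how two-sidedness enters the construction of ideals.\<close>

lemma conj_add:
  assumes "a \<in> carrier B" "b \<in> carrier B" "c \<in> carrier B"
  shows "c \<otimes> (a \<oplus> b) \<otimes> inv c = (c \<otimes> a \<otimes> inv c) \<oplus> (c \<otimes> b \<otimes> inv c)"
  using assms by (simp add: left_skew_distrib minus_add_mult r_inv) (simp add: one_eq_zero a_minus_def)

lemma group_hom_conj:
  "c \<in> carrier B \<Longrightarrow> group_hom (add_monoid B) (add_monoid B) (\<lambda>x. c \<otimes> x \<otimes> inv c)"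
  by (auto intro!: group_hom.intro group_hom_axioms.intro homI add_group simp: conj_add)

lemma conj_minus:
  "\<lbrakk>a \<in> carrier B; c \<in> carrier B\<rbrakk> \<Longrightarrow> c \<otimes> \<ominus> a \<otimes> inv c = \<ominus> (c \<otimes> a \<otimes> inv c)"
  using group_hom.hom_inv[OF group_hom_conj, of c a] by (simp add: a_inv_def)

lemma conj_star:
  assumes "a \<in> carrier B" "b \<in> carrier B" "c \<in> carrier B"
  shows "c \<otimes> star B a b \<otimes> inv c = star B (c \<otimes> a \<otimes> inv c) (c \<otimes> b \<otimes> inv c)"
  using assms
  by (simp add: star_def a_minus_def conj_add conj_minus) (simp add: m_assoc inv_mult_cancel_left)

lemma conj_add_commutator:
  assumes "a \<in> carrier B" "b \<in> carrier B" "c \<in> carrier B"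
  shows "c \<otimes> add_commutator B a b \<otimes> inv c = add_commutator B (c \<otimes> a \<otimes> inv c) (c \<otimes> b \<otimes> inv c)"
  using assms by (simp add: add_commutator_def a_minus_def conj_add conj_minus)

lemma star_add_left:
  assumes "a \<in> carrier B" "b \<in> carrier B" "c \<in> carrier B"
  shows "star B (a \<oplus> b) c = \<ominus> b \<oplus> star B a c \<oplus> b \<oplus> star B b c"
  using assms by (simp add: star_def right_skew_distrib add_simps)

text \<open>Additive conjugation, the lambda maps and multiplicative conjugation are all additive
  endomorphisms, so stability can be checked on generators.\<close>

lemma brace_ideal_generate:
  assumes S: "S \<subseteq> carrier B"
    and add: "\<And>b x. \<lbrakk>b \<in> carrier B; x \<in> S\<rbrakk> \<Longrightarrow> b \<oplus> x \<ominus> b \<in> generate (add_monoid B) S"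
    and lam: "\<And>b x. \<lbrakk>b \<in> carrier B; x \<in> S\<rbrakk> \<Longrightarrow> \<Lambda> b x \<in> generate (add_monoid B) S"
    and conj: "\<And>b x. \<lbrakk>b \<in> carrier B; x \<in> S\<rbrakk> \<Longrightarrow> b \<otimes> x \<otimes> inv b \<in> generate (add_monoid B) S"
  shows "brace_ideal (generate (add_monoid B) S) B"
proof (rule brace_idealI)
  have "group_hom (add_monoid B) (add_monoid B) (\<lambda>x. b \<oplus> x \<ominus> b)" if "b \<in> carrier B" for b
    using that
    by (auto intro!: group_hom.intro group_hom_axioms.intro homI add_group simp: add_simps)
  then show "generate (add_monoid B) S \<lhd> add_monoid B"
    using image_generate_subset[OF _ S] add add.generate_is_subgroup[OF S]
    by (auto simp: add.normal_inv_iff a_minus_def image_subset_iff)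
next
  fix b x assume "b \<in> carrier B" "x \<in> generate (add_monoid B) S"
  then show "\<Lambda> b x \<in> generate (add_monoid B) S" "b \<otimes> x \<otimes> inv b \<in> generate (add_monoid B) S"
    using image_generate_subset[OF group_hom_lambda S] image_generate_subset[OF group_hom_conj S]
      lam conj by (auto simp: image_subset_iff)
qed

end

text \<open>For \<open>star B b x\<close> this is lambda-stability. For \<open>star B x b\<close>,
  rewrite \<open>x \<otimes> b\<close> as \<open>b \<otimes> ?x\<close>, hence as
  \<open>b \<oplus> \<Lambda> b ?x\<close>, where \<open>?x\<close> is a conjugate of
  \<open>x\<close>; what remains is \<open>\<ominus> x\<close> plus an additive conjugate of
  \<open>\<Lambda> b ?x\<close>.\<close>

lemma (in skew_brace) brace_ideal_star:
  assumes I: "brace_ideal I B" and x: "x \<in> I" and b: "b \<in> carrier B"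
  shows "star B b x \<in> I" "star B x b \<in> I"
proof -
  have sub: "subgroup I (add_monoid B)" and nrm: "I \<lhd> add_monoid B" and mnrm: "I \<lhd> B"
    and lam: "\<And>y. y \<in> I \<Longrightarrow> \<Lambda> b y \<in> I"
    using I b by (auto simp: brace_ideal_def normal_imp_subgroup)
  have Ic: "\<And>y. y \<in> I \<Longrightarrow> y \<in> carrier B" using subgroup.subset[OF sub] by auto
  have closed: "\<And>y z. \<lbrakk>y \<in> I; z \<in> I\<rbrakk> \<Longrightarrow> y \<oplus> z \<in> I" "\<And>y. y \<in> I \<Longrightarrow> \<ominus> y \<in> I"
    using subgroup.m_closed[OF sub] subgroup.m_inv_closed[OF sub] by (simp_all add: a_inv_def)
  show "star B b x \<in> I"
    using x b lam closed Ic by (simp add: star_eq_lambda a_minus_def)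
  let ?x = "inv b \<otimes> x \<otimes> b"
  have "?x \<in> I" using normal.inv_op_closed1[OF mnrm b x] .
  then have "\<ominus> x \<oplus> (b \<oplus> \<Lambda> b ?x \<oplus> \<ominus> b) \<in> I"
    using normal.inv_op_closed2[OF nrm, of b "\<Lambda> b ?x"] closed x lam b by (simp add: a_inv_def)
  also have "b \<oplus> \<Lambda> b ?x = x \<otimes> b"
    using x b Ic by (simp flip: mult_eq_lambda) (simp add: m_assoc mult_inv_cancel_left)
  finally show "star B x b \<in> I"
    using x b Ic by (simp add: star_def add_simps)
qed

lemma (in skew_brace) star_in_brace_square:
  "\<lbrakk>a \<in> carrier B; b \<in> carrier B\<rbrakk> \<Longrightarrow> star B a b \<in> brace_square B"
  unfolding brace_square_def star_set_def by (rule generate.incl) blast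

lemma (in two_sided_skew_brace) brace_ideal_brace_square: "brace_ideal (brace_square B) B"
  unfolding brace_square_def star_set_def
proof (rule brace_ideal_generate)
  let ?S = "{star B x y | x y. x \<in> carrier B \<and> y \<in> carrier B}"
  let ?I = "generate (add_monoid B) ?S"
  show S: "?S \<subseteq> carrier B" by auto
  have star: "\<And>x y. \<lbrakk>x \<in> carrier B; y \<in> carrier B\<rbrakk> \<Longrightarrow> star B x y \<in> ?I"
    by (rule generate.incl) blast
  have sub: "subgroup ?I (add_monoid B)" using add.generate_is_subgroup S by simp
  have closed: "\<And>y z. \<lbrakk>y \<in> ?I; z \<in> ?I\<rbrakk> \<Longrightarrow> y \<oplus> z \<in> ?I" "\<And>y. y \<in> ?I \<Longrightarrow> \<ominus> y \<in> ?I"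
    using subgroup.m_closed[OF sub] subgroup.m_inv_closed[OF sub] by (simp_all add: a_inv_def)
  fix b x assume b: "b \<in> carrier B" and "x \<in> ?S"
  then obtain u v where x: "x = star B u v" "u \<in> carrier B" "v \<in> carrier B" by blast
  \<comment> \<open>\<open>star_add_right\<close> solved for the conjugated term.\<close>
  have "b \<oplus> x \<ominus> b = \<ominus> star B u b \<oplus> star B u (b \<oplus> v)"
    using b x by (simp add: star_add_right add_simps)
  also have "\<dots> \<in> ?I" using b x closed star by simp
  finally show "b \<oplus> x \<ominus> b \<in> ?I" .
  show "\<Lambda> b x \<in> ?I" using b x closed star by (simp add: lambda_star a_minus_def)
  show "b \<otimes> x \<otimes> inv b \<in> ?I" using b x star by (simp add: conj_star)
qed

section \<open>The opposite skew brace as a duality\<close>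

lemma opposite_simps [simp]:
  "carrier (opposite B) = carrier B" "mult (opposite B) = mult B" "one (opposite B) = one B"
  "zero (opposite B) = zero B" "a \<oplus>\<^bsub>opposite B\<^esub> b = b \<oplus>\<^bsub>B\<^esub> a"
  by (simp_all add: opposite_def)

lemma opposite_opposite [simp]: "opposite (opposite B) = B"
  by (simp add: opposite_def)

lemma opposite_carrier_update: "opposite (B\<lparr>carrier := S\<rparr>) = (opposite B)\<lparr>carrier := S\<rparr>"
  by (simp add: opposite_def)

text \<open>The inverse is specified by a two-sided condition, symmetric in the order of addition,
  so the equation holds for an arbitrary record.\<close>

lemma a_inv_opposite [simp]: "\<ominus>\<^bsub>opposite B\<^esub> a = \<ominus>\<^bsub>B\<^esub> a"
  unfolding a_inv_def m_inv_def by (simp add: conj_commute)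

lemma m_inv_opposite [simp]: "inv\<^bsub>opposite B\<^esub> a = inv\<^bsub>B\<^esub> a"
  by (simp add: m_inv_def)

text \<open>The form that the additive inverse in \<^term>\<open>opposite B\<close> takes after simplification.\<close>

lemma m_inv_opposite_monoid [simp]:
  "inv\<^bsub>\<lparr>carrier = carrier B, mult = (\<oplus>\<^bsub>opposite B\<^esub>), one = \<zero>\<^bsub>B\<^esub>, \<dots> = undefined\<rparr>\<^esub> a = \<ominus>\<^bsub>B\<^esub> a"
  unfolding a_inv_def m_inv_def by (simp add: conj_commute)

text \<open>Swapping the factors in the inductive definition gives one inclusion for every record;
  the other follows because \<open>opposite\<close> is an involution.\<close>

lemma generate_opposite:
  "generate (add_monoid (opposite B)) S = generate (add_monoid B) S"
proof -
  have sub: "generate (add_monoid (opposite C)) S \<subseteq> generate (add_monoid C) S"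
    for C :: "('a, 'b) ring_scheme"
  proof
    fix x assume "x \<in> generate (add_monoid (opposite C)) S"
    then show "x \<in> generate (add_monoid C) S"
    proof induction
      case one then show ?case using generate.one[of "add_monoid C" S] by simp
    next
      case (incl h) then show ?case by (rule generate.incl)
    next
      case (inv h) then show ?case
        using generate.inv[of h S "add_monoid C"] by (simp flip: a_inv_def)
    next
      case (eng h1 h2) then show ?case using generate.eng[of h2 "add_monoid C" S h1] by simp
    qed
  qed
  show ?thesis using sub[of B] sub[of "opposite B"] by (simp only: opposite_opposite)
qed

lemma (in skew_brace) skew_brace_opposite: "skew_brace (opposite B)"
proof (rule skew_brace.intro)
  show "group (add_monoid (opposite B))"
    by (rule groupI) (auto simp: add.m_assoc intro: bexI[of _ "\<ominus> _"])
  show "group (opposite B)"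
    by (rule groupI) (auto simp: m_assoc)
  fix a b c assume "a \<in> carrier (opposite B)" "b \<in> carrier (opposite B)" "c \<in> carrier (opposite B)"
  then show "a \<otimes>\<^bsub>opposite B\<^esub> (b \<oplus>\<^bsub>opposite B\<^esub> c)
      = a \<otimes>\<^bsub>opposite B\<^esub> b \<ominus>\<^bsub>opposite B\<^esub> a \<oplus>\<^bsub>opposite B\<^esub> a \<otimes>\<^bsub>opposite B\<^esub> c"
    by (simp add: left_skew_distrib add_simps)
qed

lemma (in two_sided_skew_brace) two_sided_skew_brace_opposite: "two_sided_skew_brace (opposite B)"
proof (intro two_sided_skew_brace.intro skew_brace_opposite two_sided_skew_brace_axioms.intro)
  fix a b c assume "a \<in> carrier (opposite B)" "b \<in> carrier (opposite B)" "c \<in> carrier (opposite B)"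
  then show "(a \<oplus>\<^bsub>opposite B\<^esub> b) \<otimes>\<^bsub>opposite B\<^esub> c
      = a \<otimes>\<^bsub>opposite B\<^esub> c \<ominus>\<^bsub>opposite B\<^esub> c \<oplus>\<^bsub>opposite B\<^esub> b \<otimes>\<^bsub>opposite B\<^esub> c"
    by (simp add: right_skew_distrib add_simps)
qed

context skew_brace
begin

lemma star_opposite:
  "\<lbrakk>a \<in> carrier B; b \<in> carrier B\<rbrakk> \<Longrightarrow> star (opposite B) a b = \<ominus> b \<oplus> a \<otimes> b \<ominus> a"
  by (simp add: star_def add_simps)

lemma subgroup_opposite:
  "subgroup N (add_monoid (opposite B)) \<Longrightarrow> subgroup N (add_monoid B)"
  by (auto simp: subgroup_def simp flip: a_inv_def)

text \<open>The lambda maps of \<open>B\<close> and of its opposite differ by additive conjugation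
  by \<open>b\<close>, under which a normal subgroup is stable.\<close>

lemma brace_ideal_opposite:
  assumes "brace_ideal N (opposite B)"
  shows "brace_ideal N B"
proof -
  interpret op: skew_brace "opposite B" by (rule skew_brace_opposite)
  have N: "N \<lhd> add_monoid (opposite B)" "N \<lhd> opposite B"
    and lam: "\<And>b x. \<lbrakk>b \<in> carrier B; x \<in> N\<rbrakk> \<Longrightarrow> lambda_map (opposite B) b x \<in> N"
    using assms by (auto simp: brace_ideal_def)
  have sub: "subgroup N (add_monoid B)"
    using N(1) by (intro subgroup_opposite normal_imp_subgroup)
  have Nc: "\<And>x. x \<in> N \<Longrightarrow> x \<in> carrier B" using subgroup.subset[OF sub] by auto
  have conj: "\<ominus> b \<oplus> x \<oplus> b \<in> N" if "b \<in> carrier B" "x \<in> N" for b x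
    using normal.inv_op_closed2[OF N(1), of b x] that Nc
    by (simp add: add.m_assoc flip: a_inv_def)
  have nrm: "b \<oplus> x \<ominus> b \<in> N" if "b \<in> carrier B" "x \<in> N" for b x
    using conj[of "\<ominus> b" x] that by (simp add: a_minus_def)
  show ?thesis
  proof (rule brace_idealI)
    show "N \<lhd> add_monoid B" using sub nrm by (simp add: add.normal_inv_iff a_minus_def)
    fix b x assume b: "b \<in> carrier B" and x: "x \<in> N"
    have "\<Lambda> b x = \<ominus> b \<oplus> lambda_map (opposite B) b x \<oplus> b"
      using b x Nc by (simp add: lambda_map_def add_simps)
    then show "\<Lambda> b x \<in> N" using conj b x lam by simp
    show "b \<otimes> x \<otimes> inv b \<in> N"
      using normal.inv_op_closed2[OF N(2), of b x] b x by simp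
  qed
qed

text \<open>The commutator of \<open>x\<close> and \<open>y\<close> in the opposite group is the
  ordinary commutator of \<open>\<ominus> y\<close> and \<open>\<ominus> x\<close>.\<close>

lemma derived_opposite:
  assumes "subgroup H (add_monoid B)"
  shows "derived (add_monoid (opposite B)) H = derived (add_monoid B) H"
proof -
  have inv: "\<And>x. x \<in> H \<Longrightarrow> \<ominus> x \<in> H" and Hc: "\<And>x. x \<in> H \<Longrightarrow> x \<in> carrier B"
    using subgroup.m_inv_closed[OF assms] subgroup.subset[OF assms] by (auto simp: a_inv_def)
  have "derived_set (add_monoid (opposite B)) H = derived_set (add_monoid B) H" (is "?L = ?R")
  proof (intro equalityI subsetI)
    fix z assume "z \<in> ?L"
    then obtain x y where xy: "x \<in> H" "y \<in> H" "z = \<ominus> y \<oplus> (\<ominus> x \<oplus> (y \<oplus> x))"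
      by (auto simp flip: a_inv_def)
    then have "z = \<ominus> y \<oplus> \<ominus> x \<oplus> \<ominus> (\<ominus> y) \<oplus> \<ominus> (\<ominus> x)"
      using Hc by (simp add: add.m_assoc)
    then show "z \<in> ?R" using inv xy by (auto simp flip: a_inv_def)
  next
    fix z assume "z \<in> ?R"
    then obtain x y where xy: "x \<in> H" "y \<in> H" "z = x \<oplus> y \<oplus> \<ominus> x \<oplus> \<ominus> y"
      by (auto simp flip: a_inv_def)
    then have "z = \<ominus> (\<ominus> x) \<oplus> (\<ominus> (\<ominus> y) \<oplus> (\<ominus> x \<oplus> \<ominus> y))"
      using Hc by (simp add: add.m_assoc)
    then show "z \<in> ?L" using inv xy by (auto simp flip: a_inv_def)
  qed
  then show ?thesis by (simp only: derived_def generate_opposite)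
qed

end

section \<open>Generated subgroups, the commutator ideal and additive perfectness\<close>

lemma (in group) generate_pointwise_commute:
  assumes S: "S \<subseteq> carrier G" and T: "T \<subseteq> carrier G"
    and comm: "\<And>s t. \<lbrakk>s \<in> S; t \<in> T\<rbrakk> \<Longrightarrow> s \<otimes> t = t \<otimes> s"
    and x: "x \<in> generate G S" and y: "y \<in> generate G T"
  shows "x \<otimes> y = y \<otimes> x"
proof -
  have centralizer: "subgroup {x \<in> carrier G. \<forall>t\<in>U. x \<otimes> t = t \<otimes> x} G" if U: "U \<subseteq> carrier G" for U
  proof (rule subgroupI)
    fix x assume "x \<in> {x \<in> carrier G. \<forall>t\<in>U. x \<otimes> t = t \<otimes> x}"
    then have x: "x \<in> carrier G" "\<And>t. t \<in> U \<Longrightarrow> x \<otimes> t = t \<otimes> x" by auto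
    have "inv x \<otimes> t = t \<otimes> inv x" if "t \<in> U" for t
    proof -
      have "t \<in> carrier G" using that U by blast
      then have "inv x \<otimes> t = inv x \<otimes> (t \<otimes> x) \<otimes> inv x" using x(1) by (simp add: m_assoc)
      also have "\<dots> = inv x \<otimes> (x \<otimes> t) \<otimes> inv x" using x(2)[OF that] by simp
      also have "\<dots> = t \<otimes> inv x" using x(1) \<open>t \<in> carrier G\<close> by (simp add: inv_mult_cancel_left)
      finally show ?thesis .
    qed
    then show "inv x \<in> {x \<in> carrier G. \<forall>t\<in>U. x \<otimes> t = t \<otimes> x}" using x(1) by simp
  next
    fix x y assume "x \<in> {x \<in> carrier G. \<forall>t\<in>U. x \<otimes> t = t \<otimes> x}"
      "y \<in> {x \<in> carrier G. \<forall>t\<in>U. x \<otimes> t = t \<otimes> x}"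
    then show "x \<otimes> y \<in> {x \<in> carrier G. \<forall>t\<in>U. x \<otimes> t = t \<otimes> x}"
      using U by (auto simp: subset_iff) (metis m_assoc)
  qed (use U in \<open>auto intro!: exI[of _ \<one>]\<close>)
  \<comment> \<open>One side at a time: the centralizer of \<open>T\<close> contains
    \<open>S\<close>, hence \<open>generate G S\<close>; then the centralizer of
    \<open>generate G S\<close> contains \<open>T\<close>, hence
    \<open>generate G T\<close>.\<close>
  have "generate G S \<subseteq> {x \<in> carrier G. \<forall>t\<in>T. x \<otimes> t = t \<otimes> x}"
    using S comm by (intro generate_subgroup_incl centralizer T) auto
  then have "generate G T \<subseteq> {t \<in> carrier G. \<forall>x\<in>generate G S. t \<otimes> x = x \<otimes> t}"
    using S T subgroup_self by (intro generate_subgroup_incl centralizer) auto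
  then show ?thesis using x y by auto
qed

context skew_brace
begin

abbreviation stars_and_commutators :: "'a set"
  where "stars_and_commutators \<equiv> {star B x y | x y. x \<in> carrier B \<and> y \<in> carrier B}
    \<union> {add_commutator B x y | x y. x \<in> carrier B \<and> y \<in> carrier B}"

lemma add_commutator_closed [simp]:
  "\<lbrakk>x \<in> carrier B; y \<in> carrier B\<rbrakk> \<Longrightarrow> add_commutator B x y \<in> carrier B"
  by (simp add: add_commutator_def a_minus_def)

lemma stars_and_commutators_closed: "stars_and_commutators \<subseteq> carrier B"
  by auto

end

text \<open>With all additive commutators among the generators, additive normality is immediate. The
  lambda maps and multiplicative conjugation send commutators to commutators, and stars to stars or
  differences of stars.\<close>

lemma (in two_sided_skew_brace) brace_ideal_stars_and_commutators:
  "brace_ideal (generate (add_monoid B) stars_and_commutators) B"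
proof (rule brace_ideal_generate[OF stars_and_commutators_closed])
  let ?S = "stars_and_commutators"
  let ?E = "generate (add_monoid B) ?S"
  have star: "\<And>x y. \<lbrakk>x \<in> carrier B; y \<in> carrier B\<rbrakk> \<Longrightarrow> star B x y \<in> ?E"
    and comm: "\<And>x y. \<lbrakk>x \<in> carrier B; y \<in> carrier B\<rbrakk> \<Longrightarrow> add_commutator B x y \<in> ?E"
    by (rule generate.incl, blast)+
  have sub: "subgroup ?E (add_monoid B)"
    using add.generate_is_subgroup[OF stars_and_commutators_closed] by simp
  have closed: "\<And>y z. \<lbrakk>y \<in> ?E; z \<in> ?E\<rbrakk> \<Longrightarrow> y \<oplus> z \<in> ?E" "\<And>y. y \<in> ?E \<Longrightarrow> \<ominus> y \<in> ?E"
    using subgroup.m_closed[OF sub] subgroup.m_inv_closed[OF sub] by (simp_all add: a_inv_def)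
  fix b x assume b: "b \<in> carrier B" and x: "x \<in> ?S"
  have "x \<in> ?E" using x by (rule generate.incl)
  moreover have "x \<in> carrier B" using subsetD[OF stars_and_commutators_closed x] .
  moreover have "b \<oplus> x \<ominus> b = add_commutator B b x \<oplus> x"
    using b \<open>x \<in> carrier B\<close> by (simp add: add_commutator_def add_simps)
  ultimately show "b \<oplus> x \<ominus> b \<in> ?E" using comm closed b by simp
  have "\<Lambda> b x \<in> ?E \<and> b \<otimes> x \<otimes> inv b \<in> ?E"
    using x
  proof
    assume "x \<in> {star B x y | x y. x \<in> carrier B \<and> y \<in> carrier B}"
    then obtain u v where "x = star B u v" "u \<in> carrier B" "v \<in> carrier B" by blast
    then show ?thesis using b closed star by (simp add: lambda_star conj_star a_minus_def)
  next
    assume "x \<in> {add_commutator B x y | x y. x \<in> carrier B \<and> y \<in> carrier B}"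
    then obtain u v where "x = add_commutator B u v" "u \<in> carrier B" "v \<in> carrier B" by blast
    then show ?thesis using b comm by (simp add: lambda_add_commutator conj_add_commutator)
  qed
  then show "\<Lambda> b x \<in> ?E" "b \<otimes> x \<otimes> inv b \<in> ?E" by auto
qed

text \<open>Modulo the ideal on the right, \<open>a \<oplus> b\<close>, \<open>b \<oplus> a\<close>,
  \<open>a \<otimes> b\<close> and \<open>b \<otimes> a\<close> agree, so it contains the generators
  of the commutator ideal. Perfectness thereby becomes a statement about additive
  generation.\<close>

lemma (in two_sided_skew_brace) commutator_ideal_subset_generate:
  "commutator_ideal B \<subseteq> generate (add_monoid B) stars_and_commutators"
proof -
  let ?E = "generate (add_monoid B) stars_and_commutators"
  have star: "\<And>x y. \<lbrakk>x \<in> carrier B; y \<in> carrier B\<rbrakk> \<Longrightarrow> star B x y \<in> ?E"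
    and comm: "\<And>x y. \<lbrakk>x \<in> carrier B; y \<in> carrier B\<rbrakk> \<Longrightarrow> add_commutator B x y \<in> ?E"
    by (rule generate.incl, blast)+
  have ideal: "brace_ideal ?E B" by (rule brace_ideal_stars_and_commutators)
  then have nrm: "?E \<lhd> add_monoid B" and sub: "subgroup ?E (add_monoid B)"
    by (auto simp: brace_ideal_def normal_imp_subgroup)
  have Ec: "\<And>x. x \<in> ?E \<Longrightarrow> x \<in> carrier B" using subgroup.subset[OF sub] by auto
  have closed: "\<And>y z. \<lbrakk>y \<in> ?E; z \<in> ?E\<rbrakk> \<Longrightarrow> y \<oplus> z \<in> ?E" "\<And>y. y \<in> ?E \<Longrightarrow> \<ominus> y \<in> ?E"
    using subgroup.m_closed[OF sub] subgroup.m_inv_closed[OF sub] by (simp_all add: a_inv_def)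
  have conj: "b \<oplus> y \<ominus> b \<in> ?E" if "b \<in> carrier B" "y \<in> ?E" for b y
    using normal.inv_op_closed2[OF nrm, of b y] that by (simp add: a_minus_def flip: a_inv_def)
  have prod: "a \<otimes> b \<ominus> (a \<oplus> b) \<in> ?E" if "a \<in> carrier B" "b \<in> carrier B" for a b
  proof -
    have "a \<otimes> b \<ominus> (a \<oplus> b) = a \<oplus> star B a b \<ominus> a"
      using that by (simp add: mult_eq_star add_simps)
    then show ?thesis using conj star that by simp
  qed
  have "mult_commutator B a b \<in> ?E" if ab: "a \<in> carrier B" "b \<in> carrier B" for a b
  proof -
    let ?v = "b \<otimes> a"
    let ?e = "a \<otimes> b \<ominus> ?v"
    have "?e = (a \<otimes> b \<ominus> (a \<oplus> b)) \<oplus> (add_commutator B a b \<oplus> \<ominus> (?v \<ominus> (b \<oplus> a)))"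
      using ab by (simp add: add_commutator_def add_simps)
    also have "\<dots> \<in> ?E" using closed prod comm ab by simp
    finally have e: "?e \<in> ?E" .
    \<comment> \<open>Right distributivity applied to \<open>a \<otimes> b = ?e \<oplus> ?v\<close>
      produces \<open>?v \<otimes> inv ?v\<close>, which is zero, and leaves \<open>?e\<close> plus
      a star of \<open>?e\<close>.\<close>
    have "mult_commutator B a b = (?e \<oplus> ?v) \<otimes> inv ?v"
      using ab by (simp add: mult_commutator_def add_simps inv_mult_group m_assoc)
    also have "\<dots> = ?e \<otimes> inv ?v \<ominus> inv ?v"
      using ab right_skew_distrib[of ?e ?v "inv ?v"] Ec[OF e]
      by (simp add: one_eq_zero a_minus_def)
    also have "\<dots> = ?e \<oplus> star B ?e (inv ?v)"
      using ab Ec[OF e] by (simp add: mult_eq_star[of ?e]) (simp add: add_simps)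
    also have "\<dots> \<in> ?E" using closed e star Ec[OF e] ab by simp
    finally show ?thesis .
  qed
  then show ?thesis
    unfolding commutator_ideal_def ideal_generated_def
    using ideal comm prod by (intro Inter_lower) auto
qed

text \<open>
  A maximal proper \<open>\<lambda>\<close>-stable subgroup \<open>N\<close> above the additive derived subgroup is ruled out as in
  Nakayama's lemma: modulo \<open>N\<close> the map \<open>a \<mapsto> a * x\<close> is additive, so if its image is not zero, then
  it contains \<open>-x\<close>, that is \<open>\<lambda>\<^sub>a x \<in> N\<close> for some \<open>a\<close>, and hence \<open>x \<in> N\<close>.
\<close>

lemma (in two_sided_skew_brace) additive_group_perfect:
  assumes fin: "finite (carrier B)" and perfect: "perfect_skew_brace B"
  shows "derived (add_monoid B) (carrier B) = carrier B"
proof (rule ccontr)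
  let ?D = "derived (add_monoid B) (carrier B)"
  assume D_proper: "?D \<noteq> carrier B"
  define F where "F = {N. subgroup N (add_monoid B) \<and> ?D \<subseteq> N \<and> N \<noteq> carrier B \<and>
    (\<forall>b\<in>carrier B. \<forall>x\<in>N. \<Lambda> b x \<in> N)}"
  have "\<Lambda> b x \<in> ?D" if "b \<in> carrier B" "x \<in> ?D" for b x
  proof -
    have "\<Lambda> b ` ?D = derived (add_monoid B) (\<Lambda> b ` carrier B)"
      using group_hom.derived_img[OF group_hom_lambda[OF that(1)], of "carrier B"] by simp
    also have "\<dots> \<subseteq> ?D" using that(1) by (intro add.mono_derived) auto
    finally show ?thesis using that(2) by auto
  qed
  moreover have "subgroup ?D (add_monoid B)" using add.derived_is_subgroup[of "carrier B"] by simp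
  ultimately have "?D \<in> F" using D_proper by (simp add: F_def)
  moreover have "finite F"
    using fin by (intro finite_subset[of F "Pow (carrier B)"])
      (use subgroup.subset in \<open>fastforce simp: F_def\<close>)+
  ultimately obtain N where N: "N \<in> F" and max: "\<And>M. \<lbrakk>M \<in> F; N \<subseteq> M\<rbrakk> \<Longrightarrow> N = M"
    using finite_has_maximal[of F] by blast
  have sub: "subgroup N (add_monoid B)" and D: "?D \<subseteq> N" and N_proper: "N \<noteq> carrier B"
    and lam: "\<And>b x. \<lbrakk>b \<in> carrier B; x \<in> N\<rbrakk> \<Longrightarrow> \<Lambda> b x \<in> N"
    using N by (auto simp: F_def)
  have Nc: "\<And>x. x \<in> N \<Longrightarrow> x \<in> carrier B" using subgroup.subset[OF sub] by auto
  have closed: "\<And>y z. \<lbrakk>y \<in> N; z \<in> N\<rbrakk> \<Longrightarrow> y \<oplus> z \<in> N" "\<And>y. y \<in> N \<Longrightarrow> \<ominus> y \<in> N" "\<zero> \<in> N"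
    using subgroup.m_closed[OF sub] subgroup.m_inv_closed[OF sub] subgroup.one_closed[OF sub]
    by (simp_all add: a_inv_def)
  have comm: "add_commutator B x y \<in> N" if "x \<in> carrier B" "y \<in> carrier B" for x y
    using add.commutatorI_derived[OF that] D by (auto simp: add_commutator_def a_minus_def)
  have conj: "b \<oplus> y \<ominus> b \<in> N" if "b \<in> carrier B" "y \<in> N" for b y
  proof -
    have "b \<oplus> y \<ominus> b = add_commutator B b y \<oplus> y"
      using that Nc by (simp add: add_commutator_def add_simps)
    then show ?thesis using that comm closed Nc by simp
  qed
  \<comment> \<open>Perfectness enters here: if \<open>N\<close> contained all stars, it would
    contain the commutator ideal, which is the whole carrier.\<close>
  have "\<exists>a\<in>carrier B. \<exists>x\<in>carrier B. star B a x \<notin> N"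
  proof (rule ccontr)
    assume "\<not> ?thesis"
    then have "generate (add_monoid B) stars_and_commutators \<subseteq> N"
      using comm by (intro add.generate_subgroup_incl sub) auto
    then show False
      using commutator_ideal_subset_generate perfect N_proper Nc
      by (auto simp: perfect_skew_brace_def)
  qed
  then obtain a x where a: "a \<in> carrier B" and x: "x \<in> carrier B" and ax: "star B a x \<notin> N"
    by blast
  \<comment> \<open>\<open>M\<close> is the full preimage of the image of
    \<open>c \<mapsto> star B c x\<close> modulo \<open>N\<close>.\<close>
  define M where "M = {y \<in> carrier B. \<exists>c\<in>carrier B. y \<ominus> star B c x \<in> N}"
  have M_cases: "\<exists>c n. c \<in> carrier B \<and> n \<in> N \<and> y = n \<oplus> star B c x" if y: "y \<in> M" for y
  proof -
    obtain c where "c \<in> carrier B" "y \<in> carrier B" "y \<ominus> star B c x \<in> N"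
      using y by (auto simp: M_def)
    moreover from this have "y = (y \<ominus> star B c x) \<oplus> star B c x" using x by (simp add: add_simps)
    ultimately show ?thesis by blast
  qed
  have star_zero: "star B \<zero> x = \<zero>"
    using x by (simp add: star_def flip: one_eq_zero) (simp add: one_eq_zero a_minus_def)
  have N_M: "N \<subseteq> M"
    using Nc star_zero by (auto simp: M_def a_minus_def intro!: bexI[of _ \<zero>])
  have star_M: "star B c x \<in> M" if "c \<in> carrier B" for c
    using that x closed(3) by (auto simp: M_def a_minus_def intro!: bexI[of _ c])
  have subM: "subgroup M (add_monoid B)"
  proof (rule add.subgroupI)
    show "M \<subseteq> carrier B" by (auto simp: M_def)
    show "M \<noteq> {}" using N_M closed(3) by auto
  next
    fix y assume "y \<in> M"
    then obtain c n where y: "c \<in> carrier B" "n \<in> N" "n \<in> carrier B" "y = n \<oplus> star B c x"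
      using M_cases Nc by blast
    let ?s = "star B c x"
    let ?t = "star B (\<ominus> c) x"
    \<comment> \<open>\<open>star_add_left\<close> at \<open>c\<close> and
      \<open>\<ominus> c\<close> determines \<open>?t\<close>; it differs from
      \<open>\<ominus> ?s\<close> by a commutator, which \<open>N\<close> absorbs.\<close>
    have "c \<oplus> ?s \<oplus> \<ominus> c \<oplus> ?t = \<zero>"
      using star_add_left[of c "\<ominus> c" x] y x star_zero by simp
    then have "\<ominus> ?t = c \<oplus> ?s \<oplus> \<ominus> c"
      using y x by (intro add.inv_equality) simp_all
    then have "?t = \<ominus> (c \<oplus> ?s \<oplus> \<ominus> c)"
      using add.inv_inv[of ?t] y(1) x by simp
    then have "\<ominus> y \<ominus> star B (\<ominus> c) x
        = (\<ominus> ?s \<oplus> \<ominus> n \<ominus> \<ominus> ?s) \<oplus> add_commutator B (\<ominus> ?s) c"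
      using y x by (simp add: add_commutator_def add_simps)
    also have "\<dots> \<in> N" using conj closed comm y x by simp
    finally show "\<ominus> y \<in> M" using y x by (auto simp: M_def)
  next
    fix y z assume "y \<in> M" "z \<in> M"
    then obtain c n d m where y: "c \<in> carrier B" "n \<in> N" "n \<in> carrier B" "y = n \<oplus> star B c x"
      and z: "d \<in> carrier B" "m \<in> N" "m \<in> carrier B" "z = m \<oplus> star B d x"
      using M_cases Nc by metis
    let ?s = "star B c x"
    have "y \<oplus> z \<ominus> star B (c \<oplus> d) x
        = n \<oplus> ((?s \<oplus> m \<ominus> ?s) \<oplus> add_commutator B ?s (\<ominus> d))"
      using y z x by (simp add: star_add_left add_commutator_def add_simps)
    also have "\<dots> \<in> N" using conj closed comm y z x by simp
    finally show "y \<oplus> z \<in> M" using y z x by (auto simp: M_def)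
  qed
  have closedM: "\<And>y z. \<lbrakk>y \<in> M; z \<in> M\<rbrakk> \<Longrightarrow> y \<oplus> z \<in> M" "\<And>y. y \<in> M \<Longrightarrow> \<ominus> y \<in> M"
    using subgroup.m_closed[OF subM] subgroup.m_inv_closed[OF subM] by (simp_all add: a_inv_def)
  have "\<Lambda> b y \<in> M" if b: "b \<in> carrier B" and y: "y \<in> M" for b y
  proof -
    obtain c n where c: "c \<in> carrier B" "n \<in> N" "n \<in> carrier B" "y = n \<oplus> star B c x"
      using M_cases[OF y] Nc by blast
    then have "\<Lambda> b y = \<Lambda> b n \<oplus> (star B (b \<otimes> c) x \<oplus> \<ominus> star B b x)"
      using b x by (simp add: lambda_add lambda_star a_minus_def)
    moreover have "\<Lambda> b n \<in> M" using lam[OF b c(2)] N_M by blast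
    ultimately show ?thesis using closedM star_M b c(1) by simp
  qed
  \<comment> \<open>\<open>M\<close> contains \<open>star B a x\<close>, so it is strictly larger
    than \<open>N\<close>, and maximality makes it the whole carrier. The element to which this is
    applied is \<open>\<ominus> x\<close>.\<close>
  moreover have "M \<noteq> N" using star_M[OF a] ax by blast
  ultimately have "M = carrier B"
    using max[of M] N_M subM D by (auto simp: F_def)
  then obtain c n where c: "c \<in> carrier B" "n \<in> N" "n \<in> carrier B" "\<ominus> x = n \<oplus> star B c x"
    using M_cases[of "\<ominus> x"] x Nc by auto
  have "\<Lambda> c x = \<ominus> n \<oplus> (n \<oplus> star B c x) \<oplus> x"
    using c(1,3) x by (simp add: star_eq_lambda add_simps)
  also have "\<dots> = \<ominus> n" using c(3) x by (simp flip: c(4) add: add.m_assoc)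
  finally have "\<Lambda> c x \<in> N" using closed c(2) by simp
  \<comment> \<open>Undoing \<open>\<Lambda> c\<close> puts \<open>x\<close> into \<open>N\<close>,
    and with it \<open>star B a x\<close>, against the choice of \<open>a\<close> and
    \<open>x\<close>.\<close>
  then have "\<Lambda> (inv c) (\<Lambda> c x) \<in> N" using lam c(1) by simp
  then have "x \<in> N" using c(1) x by (simp flip: lambda_mult add: lambda_one)
  then have "star B a x \<in> N"
    using lam[OF a] closed a x by (simp add: star_eq_lambda a_minus_def)
  with ax show False ..
qed

section \<open>The two squares commute additively\<close>

lemma (in two_sided_skew_brace) brace_ideal_op_square: "brace_ideal (op_square B) B"
proof -
  interpret op: two_sided_skew_brace "opposite B" by (rule two_sided_skew_brace_opposite)
  show ?thesis
    unfolding op_square_def by (rule brace_ideal_opposite[OF op.brace_ideal_brace_square])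
qed

text \<open>Expanding \<open>(a + b)(c + d)\<close> with the two distributive laws in either order and comparing.\<close>

lemma (in two_sided_skew_brace) star_star_opposite_commute:
  assumes "a \<in> carrier B" "b \<in> carrier B" "c \<in> carrier B" "d \<in> carrier B"
  shows "star B a d \<oplus> star (opposite B) b c = star (opposite B) b c \<oplus> star B a d"
proof -
  let ?s = "star B a d" and ?t = "star (opposite B) b c"
  have "(a \<oplus> b) \<otimes> (c \<oplus> d) = (a \<oplus> b) \<otimes> c \<ominus> (a \<oplus> b) \<oplus> (a \<oplus> b) \<otimes> d"
    using assms by (simp add: left_skew_distrib)
  also have "\<dots> = a \<otimes> c \<oplus> (?t \<oplus> ?s) \<oplus> b \<otimes> d"
    using assms by (simp add: right_skew_distrib star_def add_simps)
  finally have 1: "(a \<oplus> b) \<otimes> (c \<oplus> d) = a \<otimes> c \<oplus> (?t \<oplus> ?s) \<oplus> b \<otimes> d" .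
  have "(a \<oplus> b) \<otimes> (c \<oplus> d) = a \<otimes> (c \<oplus> d) \<ominus> (c \<oplus> d) \<oplus> b \<otimes> (c \<oplus> d)"
    using assms by (simp add: right_skew_distrib)
  also have "\<dots> = a \<otimes> c \<oplus> (?s \<oplus> ?t) \<oplus> b \<otimes> d"
    using assms by (simp add: left_skew_distrib star_def add_simps)
  \<comment> \<open>The expansions differ only in the order of the middle terms; the outer terms
    cancel.\<close>
  finally have "a \<otimes> c \<oplus> (?s \<oplus> ?t) \<oplus> b \<otimes> d = a \<otimes> c \<oplus> (?t \<oplus> ?s) \<oplus> b \<otimes> d"
    using 1 by simp
  then show ?thesis using assms by (simp add: star_opposite a_minus_def)
qed

text \<open>Commutation passes from generators to generated subgroups;
  \<open>generate_opposite\<close> allows \<open>op_square B\<close> to be generated inside the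
  additive group of \<open>B\<close>.\<close>

lemma (in two_sided_skew_brace) squares_commute:
  assumes "x \<in> brace_square B" "y \<in> op_square B"
  shows "x \<oplus> y = y \<oplus> x"
proof -
  have x: "x \<in> generate (add_monoid B) {star B x y | x y. x \<in> carrier B \<and> y \<in> carrier B}"
    using assms(1) by (simp only: brace_square_def star_set_def)
  have y: "y \<in> generate (add_monoid B)
      {star (opposite B) x y | x y. x \<in> carrier B \<and> y \<in> carrier B}"
    using assms(2)
    unfolding op_square_def brace_square_def star_set_def generate_opposite by simp
  have "star (opposite B) b c \<in> carrier B" if "b \<in> carrier B" "c \<in> carrier B" for b c
    using that by (simp add: star_opposite a_minus_def)
  then show ?thesis
    by (intro add.generate_pointwise_commute[OF _ _ _ x y]) (auto intro: star_star_opposite_commute)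
qed

section \<open>Decomposition of an additively perfect two-sided skew brace\<close>

lemma (in skew_brace) generate_add_commutators_eq_carrier:
  assumes "derived (add_monoid B) (carrier B) = carrier B"
  shows "generate (add_monoid B) {add_commutator B x y | x y. x \<in> carrier B \<and> y \<in> carrier B} = carrier B"
proof -
  have "derived_set (add_monoid B) (carrier B)
      = {add_commutator B x y | x y. x \<in> carrier B \<and> y \<in> carrier B}"
    by (auto simp: add_commutator_def a_minus_def simp flip: a_inv_def)
  then show ?thesis using assms by (simp add: derived_def)
qed

text \<open>This condition replaces finiteness and perfectness in what follows. It passes to the
  opposite brace, so facts about \<open>sq\<close> can be dualized to \<open>osq\<close> and
  back.\<close>

locale add_perfect_two_sided_skew_brace = two_sided_skew_brace +
  assumes add_perfect: "derived (add_monoid B) (carrier B) = carrier B"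
begin

lemma add_perfect_two_sided_skew_brace_opposite: "add_perfect_two_sided_skew_brace (opposite B)"
proof (intro add_perfect_two_sided_skew_brace.intro two_sided_skew_brace_opposite
    add_perfect_two_sided_skew_brace_axioms.intro)
  have "derived (add_monoid (opposite B)) (carrier B) = carrier B"
    using derived_opposite[of "carrier B"] add.subgroup_self add_perfect by simp
  then show "derived (add_monoid (opposite B)) (carrier (opposite B)) = carrier (opposite B)"
    by simp
qed

abbreviation sq where "sq \<equiv> brace_square B"
abbreviation osq where "osq \<equiv> op_square B"

lemma sq_normal: "sq \<lhd> add_monoid B" and osq_normal: "osq \<lhd> add_monoid B"
  using brace_ideal_brace_square brace_ideal_op_square by (auto simp: brace_ideal_def)

lemmas sq_subgroup = normal_imp_subgroup[OF sq_normal]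
  and osq_subgroup = normal_imp_subgroup[OF osq_normal]

lemma sq_carrier: "x \<in> sq \<Longrightarrow> x \<in> carrier B" and osq_carrier: "x \<in> osq \<Longrightarrow> x \<in> carrier B"
  using subgroup.subset[OF sq_subgroup] subgroup.subset[OF osq_subgroup] by auto

lemma sq_closed: "\<lbrakk>x \<in> sq; y \<in> sq\<rbrakk> \<Longrightarrow> x \<oplus> y \<in> sq" "x \<in> sq \<Longrightarrow> \<ominus> x \<in> sq"
  and osq_closed: "\<lbrakk>x \<in> osq; y \<in> osq\<rbrakk> \<Longrightarrow> x \<oplus> y \<in> osq" "x \<in> osq \<Longrightarrow> \<ominus> x \<in> osq"
  using subgroup.m_closed[OF sq_subgroup] subgroup.m_inv_closed[OF sq_subgroup]
    subgroup.m_closed[OF osq_subgroup] subgroup.m_inv_closed[OF osq_subgroup]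
  by (simp_all add: a_inv_def)

text \<open>Commuting squares make \<open>?K\<close> a subgroup. With \<open>?s\<close> and
  \<open>?t\<close> the stars of \<open>a\<close> and \<open>b\<close> in \<open>B\<close> and in
  its opposite, \<open>a \<otimes> b\<close> is both \<open>a \<oplus> ?s \<oplus> b\<close> and
  \<open>b \<oplus> ?t \<oplus> a\<close>; comparing the two writes the commutator of
  \<open>a\<close> and \<open>b\<close> through conjugates of \<open>?s\<close> and
  \<open>?t\<close>. Commutators generate by perfectness.\<close>

lemma carrier_decomp:
  assumes "x \<in> carrier B"
  shows "\<exists>i\<in>sq. \<exists>j\<in>osq. x = i \<oplus> j"
proof -
  let ?K = "{x. \<exists>i\<in>sq. \<exists>j\<in>osq. x = i \<oplus> j}"
  let ?C = "{add_commutator B x y | x y. x \<in> carrier B \<and> y \<in> carrier B}"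
  have "subgroup ?K (add_monoid B)"
  proof (rule add.subgroupI)
    show "?K \<subseteq> carrier B" using sq_carrier osq_carrier by auto
    show "?K \<noteq> {}"
      using subgroup.one_closed[OF sq_subgroup] subgroup.one_closed[OF osq_subgroup] by auto
  next
    fix x assume "x \<in> ?K"
    then obtain i j where x: "i \<in> sq" "j \<in> osq" "x = i \<oplus> j" by auto
    then have "\<ominus> x = \<ominus> i \<oplus> \<ominus> j"
      using squares_commute[of i j] by (simp add: sq_carrier osq_carrier add.inv_mult_group)
    then show "\<ominus> x \<in> ?K" using x sq_closed osq_closed by blast
  next
    fix x y assume "x \<in> ?K" "y \<in> ?K"
    then obtain i j k l where x: "i \<in> sq" "j \<in> osq" "x = i \<oplus> j"
      and y: "k \<in> sq" "l \<in> osq" "y = k \<oplus> l" by auto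
    have "x \<oplus> y = i \<oplus> (j \<oplus> k) \<oplus> l" using x y by (simp add: sq_carrier osq_carrier add.m_assoc)
    also have "j \<oplus> k = k \<oplus> j" using squares_commute[of k j] x y by simp
    also have "i \<oplus> (k \<oplus> j) \<oplus> l = (i \<oplus> k) \<oplus> (j \<oplus> l)"
      using x y by (simp add: sq_carrier osq_carrier add.m_assoc)
    finally show "x \<oplus> y \<in> ?K" using x y sq_closed osq_closed by blast
  qed
  moreover have "?C \<subseteq> ?K"
  proof
    fix z assume "z \<in> ?C"
    then obtain a b where ab: "a \<in> carrier B" "b \<in> carrier B" and z: "z = add_commutator B a b"
      by blast
    interpret op: two_sided_skew_brace "opposite B" by (rule two_sided_skew_brace_opposite)
    let ?s = "star B a b" and ?t = "star (opposite B) a b"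
    have s: "?s \<in> sq" and t: "?t \<in> osq"
      using ab star_in_brace_square op.star_in_brace_square by (simp_all add: op_square_def)
    note [simp] = ab sq_carrier[OF s] osq_carrier[OF t]
    have "a \<oplus> ?s \<ominus> a \<in> sq" "b \<oplus> ?t \<ominus> b \<in> osq"
      using normal.inv_op_closed2[OF sq_normal, of a ?s] normal.inv_op_closed2[OF osq_normal, of b ?t]
        s t by (simp_all add: a_minus_def flip: a_inv_def)
    moreover have "z = \<ominus> (a \<oplus> ?s \<ominus> a) \<oplus> (b \<oplus> ?t \<ominus> b)"
    proof -
      have "(a \<oplus> ?s \<ominus> a) \<oplus> z = a \<oplus> ?s \<oplus> b \<ominus> a \<ominus> b"
        by (simp add: z add_commutator_def add_simps)
      also have "a \<oplus> ?s \<oplus> b = b \<oplus> ?t \<oplus> a"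
        by (simp flip: mult_eq_star) (simp add: star_opposite add_simps)
      also have "b \<oplus> ?t \<oplus> a \<ominus> a \<ominus> b = b \<oplus> ?t \<ominus> b" by (simp add: add_simps)
      finally have "\<ominus> (a \<oplus> ?s \<ominus> a) \<oplus> ((a \<oplus> ?s \<ominus> a) \<oplus> z) = \<ominus> (a \<oplus> ?s \<ominus> a) \<oplus> (b \<oplus> ?t \<ominus> b)"
        by simp
      then show ?thesis by (simp add: add.inv_mult_cancel_left z a_minus_def)
    qed
    ultimately show "z \<in> ?K" using sq_closed by blast
  qed
  ultimately have "generate (add_monoid B) ?C \<subseteq> ?K" by (intro add.generate_subgroup_incl)
  then show ?thesis
    using assms generate_add_commutators_eq_carrier[OF add_perfect] by blast
qed

text \<open>The \<open>osq\<close> component of \<open>b\<close> commutes with \<open>t\<close> and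
  drops out. Conjugation by \<open>B\<close> thus costs only commutators inside
  \<open>sq\<close>.\<close>

lemma carrier_conj_sq:
  assumes b: "b \<in> carrier B" and t: "t \<in> sq"
  shows "\<exists>i\<in>sq. b \<oplus> t \<ominus> b = i \<oplus> t \<ominus> i"
proof -
  obtain i j where ij: "i \<in> sq" "j \<in> osq" "b = i \<oplus> j" using carrier_decomp[OF b] by auto
  note [simp] = ij(3) sq_carrier[OF ij(1)] osq_carrier[OF ij(2)] sq_carrier[OF t]
  have "b \<oplus> t \<ominus> b = i \<oplus> (j \<oplus> t) \<ominus> j \<ominus> i" by (simp add: add_simps)
  also have "j \<oplus> t = t \<oplus> j" using squares_commute[OF t ij(2)] by simp
  also have "i \<oplus> (t \<oplus> j) \<ominus> j \<ominus> i = i \<oplus> t \<ominus> i" by (simp add: add_simps)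
  finally show ?thesis using ij(1) by blast
qed

text \<open>As an element of \<open>sq\<close>, \<open>z\<close> commutes with \<open>osq\<close>,
  and as an element of \<open>osq\<close> with \<open>sq\<close>; together these make up
  \<open>B\<close>.\<close>

lemma sq_inter_osq_central:
  assumes z: "z \<in> sq" "z \<in> osq" and b: "b \<in> carrier B"
  shows "z \<oplus> b = b \<oplus> z"
proof -
  obtain i j where ij: "i \<in> sq" "j \<in> osq" "b = i \<oplus> j" using carrier_decomp[OF b] by auto
  note [simp] = sq_carrier[OF ij(1)] osq_carrier[OF ij(2)] sq_carrier[OF z(1)]
  have "z \<oplus> b = z \<oplus> i \<oplus> j" by (simp add: ij(3) add.m_assoc)
  also have "z \<oplus> i = i \<oplus> z" using squares_commute[OF ij(1) z(2)] by simp
  also have "i \<oplus> z \<oplus> j = i \<oplus> (z \<oplus> j)" by (simp add: add.m_assoc)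
  also have "z \<oplus> j = j \<oplus> z" using squares_commute[OF z(1) ij(2)] .
  finally show ?thesis by (simp add: ij(3) add.m_assoc)
qed

section \<open>Vanishing of \<open>star\<close> from perfectness, and the central product\<close>

lemma inter_subgroup: "subgroup (sq \<inter> osq) (add_monoid B)"
  using add.subgroups_Inter_pair sq_subgroup osq_subgroup by simp

text \<open>Values in the additively central intersection remove the conjugation in
  \<open>star_add_left\<close>, so \<open>x \<mapsto> star B x y\<close> is a homomorphism from a
  perfect group to an abelian one.\<close>

lemma star_zero_left_if_perfect:
  assumes P: "subgroup P (add_monoid B)" "derived (add_monoid B) P = P"
    and y: "y \<in> carrier B" and star: "\<And>x. x \<in> P \<Longrightarrow> star B x y \<in> sq \<inter> osq" and x: "x \<in> P"
  shows "star B x y = \<zero>"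
proof -
  have Pc: "\<And>x. x \<in> P \<Longrightarrow> x \<in> carrier B" using subgroup.subset[OF P(1)] by auto
  have "star B x y \<in> {\<zero>}"
  proof (rule add.hom_modulo_in_subgroup_if_perfect[OF P inter_subgroup _ _ _ star _ x])
    show "subgroup {\<zero>} (add_monoid B)" using add.triv_subgroup .
    show "{\<zero>} \<subseteq> sq \<inter> osq"
      using subgroup.one_closed[OF inter_subgroup] by simp
    fix c d assume "c \<in> sq \<inter> osq" "d \<in> sq \<inter> osq"
    then show "c \<oplus> d \<oplus> \<ominus> c \<oplus> \<ominus> d \<in> {\<zero>}"
      using sq_inter_osq_central[of c d] sq_carrier by (simp add: add.m_assoc add.mult_inv_cancel_left)
  next
    fix u v assume uv: "u \<in> P" "v \<in> P"
    have "star B u y \<oplus> v = v \<oplus> star B u y"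
      using sq_inter_osq_central[of "star B u y" v] star[OF uv(1)] Pc[OF uv(2)] by auto
    then have "star B (u \<oplus> v) y = star B u y \<oplus> star B v y"
      using Pc uv y by (simp add: star_add_left add.m_assoc)
        (simp add: add.inv_mult_cancel_left flip: add.m_assoc)
    then show "star B (u \<oplus> v) y \<oplus> \<ominus> (star B u y \<oplus> star B v y) \<in> {\<zero>}"
      using Pc uv y by simp
  qed
  then show ?thesis by simp
qed

text \<open>The same argument in the other variable, with \<open>star_add_right\<close>.\<close>

lemma star_zero_right_if_perfect:
  assumes P: "subgroup P (add_monoid B)" "derived (add_monoid B) P = P"
    and y: "y \<in> carrier B" and star: "\<And>x. x \<in> P \<Longrightarrow> star B y x \<in> sq \<inter> osq" and x: "x \<in> P"
  shows "star B y x = \<zero>"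
proof -
  have Pc: "\<And>x. x \<in> P \<Longrightarrow> x \<in> carrier B" using subgroup.subset[OF P(1)] by auto
  have "star B y x \<in> {\<zero>}"
  proof (rule add.hom_modulo_in_subgroup_if_perfect[OF P inter_subgroup _ _ _ star _ x])
    show "subgroup {\<zero>} (add_monoid B)" using add.triv_subgroup .
    show "{\<zero>} \<subseteq> sq \<inter> osq"
      using subgroup.one_closed[OF inter_subgroup] by simp
    fix c d assume "c \<in> sq \<inter> osq" "d \<in> sq \<inter> osq"
    then show "c \<oplus> d \<oplus> \<ominus> c \<oplus> \<ominus> d \<in> {\<zero>}"
      using sq_inter_osq_central[of c d] sq_carrier by (simp add: add.m_assoc add.mult_inv_cancel_left)
  next
    fix u v assume uv: "u \<in> P" "v \<in> P"
    have "star B y v \<oplus> \<ominus> u = \<ominus> u \<oplus> star B y v"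
      using sq_inter_osq_central[of "star B y v" "\<ominus> u"] star[OF uv(2)] Pc[OF uv(1)] by auto
    then have "star B y (u \<oplus> v) = star B y u \<oplus> star B y v"
      using Pc uv y by (simp add: star_add_right add_simps)
    then show "star B y (u \<oplus> v) \<oplus> \<ominus> (star B y u \<oplus> star B y v) \<in> {\<zero>}"
      using Pc uv y by simp
  qed
  then show ?thesis by simp
qed

text \<open>Modulo the derived subgroup of \<open>B\<^sup>2\<close> the star operation is additive on the perfect group \<open>B\<close>.\<close>

lemma sq_perfect: "derived (add_monoid B) sq = sq"
proof
  let ?K = "derived (add_monoid B) sq"
  show "?K \<subseteq> sq" using add.derived_incl[OF _ sq_subgroup] by simp
  have K: "subgroup ?K (add_monoid B)"
    using add.derived_is_subgroup[of sq] sq_carrier by auto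
  have K_normal: "?K \<lhd> add_monoid B" using add.derived_is_normal[OF sq_normal] .
  have comm: "c \<oplus> d \<oplus> \<ominus> c \<oplus> \<ominus> d \<in> ?K" if "c \<in> sq" "d \<in> sq" for c d
    using add.commutatorI_derived[OF that] .
  have "star B a b \<in> ?K" if a: "a \<in> carrier B" and b: "b \<in> carrier B" for a b
  proof (rule add.hom_modulo_in_subgroup_if_perfect[OF add.subgroup_self add_perfect sq_subgroup K
        \<open>?K \<subseteq> sq\<close> comm star_in_brace_square[OF a] _ b])
    fix u v assume uv: "u \<in> carrier B" "v \<in> carrier B"
    let ?s = "star B a u" and ?t = "star B a v"
    have t: "?t \<in> sq" using star_in_brace_square[OF a uv(2)] .
    \<comment> \<open>Replacing \<open>u\<close> by an element of \<open>sq\<close> turns the defect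
      of additivity into a conjugate of a commutator of two elements of \<open>sq\<close>.\<close>
    obtain i where i: "i \<in> sq" "u \<oplus> ?t \<ominus> u = i \<oplus> ?t \<ominus> i"
      using carrier_conj_sq[OF uv(1) t] by auto
    have "star B a (u \<oplus> v) = ?s \<oplus> (u \<oplus> ?t \<ominus> u)"
      using a uv by (simp add: star_add_right add_simps)
    also have "\<dots> = ?s \<oplus> (i \<oplus> ?t \<ominus> i)" by (simp only: i(2))
    finally have "star B a (u \<oplus> v) \<oplus> \<ominus> (?s \<oplus> ?t) = ?s \<oplus> (i \<oplus> ?t \<oplus> \<ominus> i \<oplus> \<ominus> ?t) \<oplus> \<ominus> ?s"
      using a uv sq_carrier[OF i(1)] by (simp add: add_simps)
    also have "\<dots> \<in> ?K"
      using normal.inv_op_closed2[OF K_normal _ comm[OF i(1) t], of ?s] a uv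
      by (simp flip: a_inv_def)
    finally show "star B a (u \<oplus> v) \<oplus> \<ominus> (?s \<oplus> ?t) \<in> ?K" .
  qed
  then show "sq \<subseteq> ?K"
    unfolding brace_square_def[of B] star_set_def
    by (intro add.generate_subgroup_incl K[unfolded brace_square_def[of B] star_set_def]) auto
qed

lemma osq_perfect: "derived (add_monoid B) osq = osq"
proof -
  interpret op: add_perfect_two_sided_skew_brace "opposite B" by (rule add_perfect_two_sided_skew_brace_opposite)
  show ?thesis
    using op.sq_perfect derived_opposite[OF osq_subgroup] by (simp add: op_square_def)
qed

lemma star_in_inter:
  assumes "x \<in> sq" "y \<in> osq"
  shows "star B x y \<in> sq \<inter> osq" "star B y x \<in> sq \<inter> osq"
  using brace_ideal_star[OF brace_ideal_brace_square assms(1) osq_carrier[OF assms(2)]]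
    brace_ideal_star[OF brace_ideal_op_square assms(2) sq_carrier[OF assms(1)]] by simp_all

lemma star_sq_osq: "\<lbrakk>x \<in> sq; y \<in> osq\<rbrakk> \<Longrightarrow> star B x y = \<zero>"
  by (rule star_zero_left_if_perfect[OF sq_subgroup sq_perfect osq_carrier star_in_inter(1)])

lemma star_osq_sq: "\<lbrakk>x \<in> sq; y \<in> osq\<rbrakk> \<Longrightarrow> star B y x = \<zero>"
  by (rule star_zero_right_if_perfect[OF sq_subgroup sq_perfect osq_carrier star_in_inter(2)])

text \<open>Every star lies in \<open>sq\<close>, and the ideal \<open>osq\<close> absorbs stars, so
  the values are in the intersection. Read in the opposite brace, this also yields almost triviality
  of \<open>sq\<close>.\<close>

lemma star_osq:
  assumes "x \<in> osq" "y \<in> osq"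
  shows "star B x y = \<zero>"
proof (rule star_zero_left_if_perfect[OF osq_subgroup osq_perfect osq_carrier[OF assms(2)] _ assms(1)])
  fix u assume "u \<in> osq"
  then have "u \<in> carrier B" by (rule osq_carrier)
  then show "star B u y \<in> sq \<inter> osq"
    using star_in_brace_square[OF _ osq_carrier[OF assms(2)]]
      brace_ideal_star(1)[OF brace_ideal_op_square assms(2)] by simp
qed

lemma inter_subset_center: "sq \<inter> osq \<subseteq> brace_center B"
proof
  fix z assume z: "z \<in> sq \<inter> osq"
  then have zc: "z \<in> carrier B" using sq_carrier by blast
  have inter: "star B b z \<in> sq \<inter> osq" "star B z b \<in> sq \<inter> osq" if "b \<in> carrier B" for b
    using z brace_ideal_star[OF brace_ideal_brace_square _ that]
      brace_ideal_star[OF brace_ideal_op_square _ that] by simp_all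
  \<comment> \<open>Stars with \<open>z\<close> stay in the intersection while the other argument
    runs through all of the perfect group \<open>B\<close>, so they vanish on both sides.\<close>
  note l = star_zero_left_if_perfect[OF add.subgroup_self add_perfect zc inter(1)]
    and r = star_zero_right_if_perfect[OF add.subgroup_self add_perfect zc inter(2)]
  have comm: "z \<oplus> b = b \<oplus> z" if "b \<in> carrier B" for b
    using sq_inter_osq_central[OF _ _ that] z by simp
  have zb: "z \<otimes> b = z \<oplus> b" and bz: "b \<otimes> z = b \<oplus> z" if "b \<in> carrier B" for b
    using that zc l[of b] r[of b] by (simp_all add: mult_eq_star)
  have "\<Lambda> z b = b" if "b \<in> carrier B" for b
    using that zc by (simp add: lambda_map_def zb add.inv_mult_cancel_left)
  then show "z \<in> brace_center B"
    using zc comm by (simp add: brace_center_def zb bz)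
qed

lemma internal_central_product_squares: "internal_central_product B sq osq"
  unfolding internal_central_product_def
proof (intro conjI ballI brace_ideal_brace_square brace_ideal_op_square inter_subset_center)
  show "carrier B = sq <+>\<^bsub>B\<^esub> osq"
    using carrier_decomp sq_carrier osq_carrier by (auto simp: set_add_def set_mult_def)
  have gen: "generate (add_monoid B) S = {\<zero>}" if "S = {\<zero>}" for S
    using add.generate_one that by simp
  have "\<zero> \<in> sq" "\<zero> \<in> osq"
    using subgroup.one_closed[OF sq_subgroup] subgroup.one_closed[OF osq_subgroup] by auto
  then have sets: "{star B x y | x y. x \<in> sq \<and> y \<in> osq} = {\<zero>}"
    "{star B x y | x y. x \<in> osq \<and> y \<in> sq} = {\<zero>}"
    by (auto simp: star_sq_osq star_osq_sq intro!: exI[of _ "\<zero>"])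
  show "star_set B sq osq = {\<zero>}" "star_set B osq sq = {\<zero>}"
    unfolding star_set_def by (rule gen[OF sets(1)], rule gen[OF sets(2)])
  fix x y assume "x \<in> sq" "y \<in> osq"
  then show "add_commutator B x y = \<zero>"
    using squares_commute[of x y] sq_carrier osq_carrier
    by (simp add: add_commutator_def a_minus_def add.m_assoc add.mult_inv_cancel_left)
qed

end

section \<open>Restriction to ideals and the conclusion\<close>

lemma (in skew_brace) skew_brace_restrict:
  assumes "brace_ideal I B"
  shows "skew_brace (B\<lparr>carrier := I\<rparr>)"
proof -
  have sub: "subgroup I (add_monoid B)" "subgroup I B"
    using assms by (auto simp: brace_ideal_def normal_imp_subgroup)
  \<comment> \<open>Inverses are defined relative to the carrier, so their agreement after
    restriction needs the subgroup property.\<close>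
  have inv: "\<ominus>\<^bsub>B\<lparr>carrier := I\<rparr>\<^esub> x = \<ominus> x" if "x \<in> I" for x
    using add.m_inv_consistent[OF sub(1) that] by (simp add: a_inv_def)
  show ?thesis
  proof (rule skew_brace.intro)
    show "group (add_monoid (B\<lparr>carrier := I\<rparr>))"
      using add.subgroup_imp_group[OF sub(1)] by simp
    show "group (B\<lparr>carrier := I\<rparr>)" by (rule subgroup_imp_group[OF sub(2)])
    fix a b c
    assume "a \<in> carrier (B\<lparr>carrier := I\<rparr>)" "b \<in> carrier (B\<lparr>carrier := I\<rparr>)"
      "c \<in> carrier (B\<lparr>carrier := I\<rparr>)"
    then have "a \<in> I" "b \<in> I" "c \<in> I" by auto
    moreover from this have "a \<in> carrier B" "b \<in> carrier B" "c \<in> carrier B"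
      using subgroup.subset[OF sub(1)] by auto
    ultimately show "a \<otimes>\<^bsub>B\<lparr>carrier := I\<rparr>\<^esub> (b \<oplus>\<^bsub>B\<lparr>carrier := I\<rparr>\<^esub> c)
      = a \<otimes>\<^bsub>B\<lparr>carrier := I\<rparr>\<^esub> b \<ominus>\<^bsub>B\<lparr>carrier := I\<rparr>\<^esub> a
        \<oplus>\<^bsub>B\<lparr>carrier := I\<rparr>\<^esub> a \<otimes>\<^bsub>B\<lparr>carrier := I\<rparr>\<^esub> c"
      by (simp add: a_minus_def inv left_skew_distrib)
  qed
qed

lemma (in skew_brace) trivial_skew_brace_restrict:
  assumes I: "brace_ideal I B" and star: "\<And>x y. \<lbrakk>x \<in> I; y \<in> I\<rbrakk> \<Longrightarrow> star B x y = \<zero>"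
  shows "trivial_skew_brace (B\<lparr>carrier := I\<rparr>)"
proof -
  let ?I = "B\<lparr>carrier := I\<rparr>"
  interpret I: skew_brace ?I by (rule skew_brace_restrict[OF I])
  have sub: "subgroup I (add_monoid B)"
    using I by (auto simp: brace_ideal_def normal_imp_subgroup)
  have star_zero: "star ?I x y = \<zero>" if "x \<in> I" "y \<in> I" for x y
    using star[OF that] add.m_inv_consistent[OF sub] that
    by (simp add: star_def a_minus_def a_inv_def)
  have zero: "\<zero> \<in> I" using subgroup.one_closed[OF sub] by simp
  have "{star ?I x y | x y. x \<in> carrier ?I \<and> y \<in> carrier ?I} = {\<zero>\<^bsub>?I\<^esub>}"
    using zero by (auto simp: star_zero intro!: exI[of _ "\<zero>"])
  then have "brace_square ?I = {\<zero>\<^bsub>?I\<^esub>}"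
    unfolding brace_square_def star_set_def using I.add.generate_one by simp
  then show ?thesis
    using I.skew_brace_axioms by (simp add: trivial_skew_brace_def)
qed

lemma almost_trivial_iff_trivial_opposite:
  "almost_trivial_skew_brace A \<longleftrightarrow> trivial_skew_brace (opposite A)"
proof -
  have "skew_brace (opposite A) \<longleftrightarrow> skew_brace A"
    using skew_brace.skew_brace_opposite opposite_opposite by metis
  then show ?thesis
    by (simp add: almost_trivial_skew_brace_def trivial_skew_brace_def op_square_def)
qed

lemma (in skew_brace) perfect_group_restrict:
  assumes sub: "subgroup I (add_monoid B)" and "derived (add_monoid B) I = I"
  shows "perfect_group (add_monoid (B\<lparr>carrier := I\<rparr>))"
  using add.subgroup_imp_group[OF sub] add.derived_consistent[OF _ sub, of I] assms(2)
  by (simp add: perfect_group_def)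

theorem theorem2:
  fixes B :: "('a, 'm) ring_scheme"
  assumes "two_sided_skew_brace B"
    and "finite (carrier B)"
    and "perfect_skew_brace B"
  shows "internal_central_product B (brace_square B) (op_square B)
    \<and> (almost_trivial_skew_brace (B\<lparr>carrier := brace_square B\<rparr>)
        \<and> perfect_group (add_monoid (B\<lparr>carrier := brace_square B\<rparr>)))
    \<and> (trivial_skew_brace (B\<lparr>carrier := op_square B\<rparr>)
        \<and> perfect_group (add_monoid (B\<lparr>carrier := op_square B\<rparr>)))"
proof -
  interpret two_sided_skew_brace B by fact
  interpret add_perfect_two_sided_skew_brace B
    by unfold_locales (rule additive_group_perfect[OF assms(2,3)])
  interpret op: add_perfect_two_sided_skew_brace "opposite B" by (rule add_perfect_two_sided_skew_brace_opposite)
  \<comment> \<open>The \<open>op_square\<close> of the opposite brace is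
    \<open>brace_square B\<close>, so triviality in the opposite becomes almost triviality in
    \<open>B\<close>.\<close>
  have "op_square (opposite B) = brace_square B" by (simp add: op_square_def)
  then have "trivial_skew_brace (opposite (B\<lparr>carrier := brace_square B\<rparr>))"
    using op.trivial_skew_brace_restrict[OF op.brace_ideal_op_square op.star_osq]
    by (simp add: opposite_carrier_update)
  then show ?thesis
    using internal_central_product_squares trivial_skew_brace_restrict[OF brace_ideal_op_square star_osq]
      perfect_group_restrict[OF sq_subgroup sq_perfect] perfect_group_restrict[OF osq_subgroup osq_perfect]
    by (simp add: almost_trivial_iff_trivial_opposite)
qed

end
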